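(* Let $S$ be a topological monoid with open shifts. Then $\mathcal{C}_r(S)=\mathcal{C}_0(S_{sr})$; that is, the space $\mathcal{C}_0(S_{sr})$, together with the composition of the identity map $S\to S_{sr}$ and the $T_0$-reflection map $S_{sr}\to\mathcal{C}_0(S_{sr})$, is the reflection of $S$ in the class of regular spaces.
   Context: A topological monoid is a monoid $S$ with a topology (no separation axiom assumed) for which the operation $S\times S\to S$ is continuous. It has open shifts if for every $a\in S$ and every open $U\subseteq S$ the sets $aU$ and $Ua$ are open in $S$. For a topological space $X$, an open set $U$ is regular open if $\mathrm{Int}(\overline{U})=U$; the regular open sets form a base of a topology on the set $X$, and $X_{sr}$ (the semiregularization) denotes $X$ with this topology. A space is $T_3$ if every point and every closed set not containing it have disjoint open neighborhoods ($T_1$ is not assumed); a space is regular if it is $T_3$ and $T_1$. $\mathcal{C}_0$ and $\mathcal{C}_r$ denote the classes of $T_0$ and of regular spaces; each is epireflective in the category of topological spaces: for such a class $\mathcal{C}$ and each space $X$ there is a space $\mathcal{C}(X)\in\mathcal{C}$ and a continuous surjection $\varphi\colon X\to\mathcal{C}(X)$ (the $\mathcal{C}$-reflection) such that every continuous map $f\colon X\to Y$ with $Y\in\mathcal{C}$ factors as $f=g\circ\varphi$ for a unique continuous $g$. The pair is unique up to canonical homeomorphism, and equality is understood in this sense. *)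

theory Defs
  imports "HOL-Analysis.Analysis"
begin

definition regular_openin :: "'a topology \<Rightarrow> 'a set \<Rightarrow> bool" where
  "regular_openin X U \<longleftrightarrow> openin X U \<and> X interior_of (X closure_of U) = U"

definition semiregularization :: "'a topology \<Rightarrow> 'a topology" where
  "semiregularization X = topology (arbitrary union_of (regular_openin X))"

lemma regular_openin_Int:
  assumes "regular_openin X U" "regular_openin X V"
  shows "regular_openin X (U \<inter> V)"
proof -
  have "X interior_of (X closure_of (U \<inter> V)) \<subseteq> X interior_of (X closure_of U)"
       "X interior_of (X closure_of (U \<inter> V)) \<subseteq> X interior_of (X closure_of V)"
    by (simp_all add: closure_of_mono interior_of_mono)
  moreover have "openin X (U \<inter> V)"
    using assms by (auto simp: regular_openin_def)
  moreover have "U \<inter> V \<subseteq> X interior_of (X closure_of (U \<inter> V))"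
    using \<open>openin X (U \<inter> V)\<close>
    by (simp add: closure_of_subset interior_of_maximal openin_subset)
  ultimately show ?thesis
    using assms unfolding regular_openin_def by blast
qed

text \<open>\<open>semiregularization\<close> uses the total function \<open>topology\<close>; this lemma shows that its argument
  really is a topology, so that the regular open sets form a base of it.\<close>

lemma openin_semiregularization:
  "openin (semiregularization X) = arbitrary union_of (regular_openin X)"
  unfolding semiregularization_def
  by (intro topology_inverse' istopology_base regular_openin_Int)

lemma topspace_semiregularization [simp]:
  "topspace (semiregularization X) = topspace X"
proof
  show "topspace (semiregularization X) \<subseteq> topspace X"
  proof -
    have "(arbitrary union_of (regular_openin X)) (topspace (semiregularization X))"
      by (simp flip: openin_semiregularization)
    then obtain \<U> where \<U>: "\<U> \<subseteq> Collect (regular_openin X)"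
        "\<Union>\<U> = topspace (semiregularization X)"
      unfolding union_of_def by (elim exE conjE)
    have "U \<subseteq> topspace X" if "U \<in> \<U>" for U
    proof -
      have "regular_openin X U" using \<U>(1) that by blast
      then show ?thesis by (simp add: regular_openin_def openin_subset)
    qed
    then show ?thesis
      unfolding \<U>(2)[symmetric] by (rule Union_least)
  qed
  have "regular_openin X (topspace X)"
    by (simp add: regular_openin_def)
  then have "openin (semiregularization X) (topspace X)"
    by (simp add: openin_semiregularization arbitrary_union_of_inc)
  then show "topspace X \<subseteq> topspace (semiregularization X)"
    by (rule openin_subset)
qed

text \<open>In the library \<^const>\<open>regular_space\<close> is the separation axiom \<open>T\<^sub>3\<close> without \<open>T\<^sub>1\<close>.\<close>

definition regular_T1_space :: "'a topology \<Rightarrow> bool" where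
  "regular_T1_space X \<longleftrightarrow> regular_space X \<and> t1_space X"

text \<open>\<open>\<phi> : X \<rightarrow> Z\<close> is the reflection of \<open>X\<close> in a class of spaces.  A predicate
  inside a definition is monomorphic, so the class is passed twice: \<open>C\<close> on the type carrying \<open>Z\<close>
  and \<open>D\<close> on the type carrying the test spaces \<open>Y\<close>; both are meant to be instances of one
  polymorphic predicate.  A definition cannot quantify over types either, so ``every space \<open>Y\<close>'' is
  obtained by leaving the type \<open>'y\<close> of \<open>D\<close> free in a conclusion.  Uniqueness of \<open>g\<close> means
  uniqueness on the underlying set of \<open>Z\<close>.\<close>

definition is_reflection ::
  "('z topology \<Rightarrow> bool) \<Rightarrow> ('y topology \<Rightarrow> bool) \<Rightarrow> 'x topology \<Rightarrow> 'z topology \<Rightarrow> ('x \<Rightarrow> 'z) \<Rightarrow> bool"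
where
  "is_reflection C D X Z \<phi> \<longleftrightarrow>
     C Z \<and> continuous_map X Z \<phi> \<and> \<phi> ` topspace X = topspace Z \<and>
     (\<forall>Y f. D Y \<and> continuous_map X Y f \<longrightarrow>
        (\<exists>g. continuous_map Z Y g \<and> (\<forall>x\<in>topspace X. f x = g (\<phi> x)) \<and>
             (\<forall>h. continuous_map Z Y h \<and> (\<forall>x\<in>topspace X. f x = h (\<phi> x)) \<longrightarrow>
                  (\<forall>z\<in>topspace Z. h z = g z))))"

text \<open>For \<open>T\<^sub>0\<close>-reflections it suffices to test against spaces carried by the type of \<open>X\<close>, because a
  map out of \<open>X\<close> factors through its image.\<close>

lemma is_reflection_t0_space_any_type:
  fixes X :: "'x topology" and Z :: "'z topology"
  assumes "is_reflection t0_space (t0_space :: 'x topology \<Rightarrow> bool) X Z \<phi>"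
  shows "is_reflection t0_space (t0_space :: 'y topology \<Rightarrow> bool) X Z \<phi>"
proof -
  have Z: "t0_space Z" "continuous_map X Z \<phi>" "\<phi> ` topspace X = topspace Z"
    and univ: "\<And>(Y :: 'x topology) f. t0_space Y \<Longrightarrow> continuous_map X Y f \<Longrightarrow>
        \<exists>g. continuous_map Z Y g \<and> (\<forall>x\<in>topspace X. f x = g (\<phi> x))"
    using assms unfolding is_reflection_def by blast+
  have ex: "\<exists>g. continuous_map Z Y g \<and> (\<forall>x\<in>topspace X. f x = g (\<phi> x))"
    if Y: "t0_space Y" and f: "continuous_map X Y f" for Y :: "'y topology" and f
  proof -
    define W where "W = f ` topspace X"
    define r where "r = inv_into (topspace X) f"
    define Y' where "Y' = pullback_topology (r ` W) f Y"
    have fr: "f (r w) = w" if "w \<in> W" for w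
      using that by (auto simp: W_def r_def f_inv_into_f)
    have WY: "W \<subseteq> topspace Y"
      using f by (auto simp: W_def continuous_map_def)
    have cf: "continuous_map Y' Y f"
      using continuous_map_pullback[of Y Y id "r ` W" f] by (simp add: Y'_def)
    have cr: "continuous_map (subtopology Y W) Y' r"
      unfolding Y'_def
    proof (rule continuous_map_pullback')
      have "continuous_map (subtopology Y W) Y id"
        by (simp add: continuous_map_from_subtopology)
      then show "continuous_map (subtopology Y W) Y (f \<circ> r)"
        by (rule continuous_map_eq) (simp add: fr)
      show "topspace (subtopology Y W) \<subseteq> r -` (r ` W)"
        by auto
    qed
    have "t0_space Y'"
      unfolding t0_space_def
    proof (intro ballI impI)
      fix a b assume ab: "a \<in> topspace Y'" "b \<in> topspace Y'" "a \<noteq> b"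
      then have "f a \<in> topspace Y" "f b \<in> topspace Y" "f a \<noteq> f b"
        by (auto simp: Y'_def topspace_pullback_topology fr)
      then obtain U where U: "openin Y U" "f a \<notin> U \<longleftrightarrow> f b \<in> U"
        using Y unfolding t0_space_def by metis
      show "\<exists>U. openin Y' U \<and> (a \<notin> U \<longleftrightarrow> b \<in> U)"
        using U ab openin_continuous_map_preimage[OF cf U(1)]
        by (intro exI[of _ "{x \<in> topspace Y'. f x \<in> U}"]) auto
    qed
    moreover have "continuous_map X Y' (r \<circ> f)"
      using f cr by (intro continuous_map_compose[where X' = "subtopology Y W"])
        (auto simp: continuous_map_in_subtopology W_def)
    ultimately obtain g where g: "continuous_map Z Y' g" "\<forall>x\<in>topspace X. (r \<circ> f) x = g (\<phi> x)"
      using univ by blast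
    have "continuous_map Z Y (f \<circ> g)"
      using g(1) cf by (rule continuous_map_compose)
    moreover have "\<forall>x\<in>topspace X. f x = (f \<circ> g) (\<phi> x)"
      using g(2) fr by (metis W_def comp_apply imageI)
    ultimately show ?thesis by blast
  qed
  show ?thesis
    unfolding is_reflection_def
  proof (intro conjI allI impI; (elim conjE)?)
    fix Y :: "'y topology" and f
    assume "t0_space Y" "continuous_map X Y f"
    then obtain g where "continuous_map Z Y g" "\<forall>x\<in>topspace X. f x = g (\<phi> x)"
      using ex by blast
    then show "\<exists>g. continuous_map Z Y g \<and> (\<forall>x\<in>topspace X. f x = g (\<phi> x)) \<and>
             (\<forall>h. continuous_map Z Y h \<and> (\<forall>x\<in>topspace X. f x = h (\<phi> x)) \<longrightarrow>
                  (\<forall>z\<in>topspace Z. h z = g z))"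
      using Z(3) by (metis imageE)
  qed (use Z in auto)
qed

lemma t0_reflection_exists:
  fixes X :: "'x topology"
  shows "\<exists>(Z :: 'x topology) \<phi>. is_reflection t0_space (t0_space :: 'y topology \<Rightarrow> bool) X Z \<phi>"
proof -
  define E where "E x y \<longleftrightarrow> y \<in> topspace X \<and> (\<forall>U. openin X U \<longrightarrow> (x \<in> U \<longleftrightarrow> y \<in> U))" for x y
  define q where "q x = (SOME y. E x y)" for x
  define Z where "Z = subtopology X (q ` topspace X)"
  have E: "E x (q x)" if "x \<in> topspace X" for x
    unfolding q_def by (rule someI[of _ x]) (use that in \<open>auto simp: E_def\<close>)
  have q_eq: "q x = q y" if "E x y" "x \<in> topspace X" for x y
  proof -
    have "E x z = E y z" for z using that unfolding E_def by blast
    then have "E x = E y" by (intro ext)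
    then show ?thesis by (simp add: q_def)
  qed
  have q_in: "q x \<in> topspace X" if "x \<in> topspace X" for x
    using E[OF that] by (simp add: E_def)
  then have tZ: "topspace Z = q ` topspace X"
    by (auto simp: Z_def)
  have qc: "continuous_map X Z q"
    unfolding Z_def continuous_map_in_subtopology
  proof
    have "{x \<in> topspace X. q x \<in> U} = U" if "openin X U" for U
    proof -
      have "q x \<in> U \<longleftrightarrow> x \<in> U" if "x \<in> topspace X" for x
        using E[OF that] \<open>openin X U\<close> unfolding E_def by blast
      then show ?thesis
        using openin_subset[OF that] by auto
    qed
    then show "continuous_map X X q"
      using q_in by (simp add: continuous_map_def)
  qed auto
  have t0: "t0_space Z"
    unfolding t0_space_def
  proof (intro ballI impI; rule ccontr)
    fix a b assume ab: "a \<in> topspace Z" "b \<in> topspace Z" "a \<noteq> b"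
      and no: "\<nexists>U. openin Z U \<and> (a \<notin> U) = (b \<in> U)"
    obtain x y where xy: "x \<in> topspace X" "a = q x" "y \<in> topspace X" "b = q y"
      using ab tZ by auto
    have "a \<in> U \<longleftrightarrow> b \<in> U" if "openin X U" for U
    proof -
      have "openin Z (U \<inter> topspace Z)"
        unfolding tZ unfolding Z_def using that by (rule openin_subtopology_Int)
      then have "a \<in> U \<inter> topspace Z \<longleftrightarrow> b \<in> U \<inter> topspace Z"
        using no by (metis (no_types))
      then show ?thesis
        using ab(1,2) by simp
    qed
    moreover have "x \<in> U \<longleftrightarrow> a \<in> U" "y \<in> U \<longleftrightarrow> b \<in> U" if "openin X U" for U
      using E[OF xy(1)] E[OF xy(3)] that by (simp_all add: E_def xy(2,4))
    ultimately have "E x y"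
      using xy(3) by (simp add: E_def)
    then show False using q_eq[of x y] xy(1,2,4) ab(3) by simp
  qed
  have "is_reflection t0_space (t0_space :: 'y topology \<Rightarrow> bool) X Z q"
    unfolding is_reflection_def
  proof (intro conjI allI impI; (elim conjE)?)
    fix Y :: "'y topology" and f
    assume Y: "t0_space Y" and f: "continuous_map X Y f"
    have "f x = f (q x)" if x: "x \<in> topspace X" for x
    proof (rule ccontr)
      assume "f x \<noteq> f (q x)"
      moreover have "f x \<in> topspace Y" "f (q x) \<in> topspace Y" "q x \<in> topspace X"
        using f x q_in[OF x] by (simp_all add: continuous_map_def Pi_iff)
      ultimately obtain U where U: "openin Y U" "f x \<notin> U \<longleftrightarrow> f (q x) \<in> U"
        using Y unfolding t0_space_def by metis
      have "openin X {x \<in> topspace X. f x \<in> U}"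
        using f U by (simp add: openin_continuous_map_preimage)
      then show False
        using E[OF x] U x unfolding E_def by blast
    qed
    moreover have "continuous_map Z Y f"
      using f by (simp add: Z_def continuous_map_from_subtopology)
    ultimately show "\<exists>g. continuous_map Z Y g \<and> (\<forall>x\<in>topspace X. f x = g (q x)) \<and>
             (\<forall>h. continuous_map Z Y h \<and> (\<forall>x\<in>topspace X. f x = h (q x)) \<longrightarrow>
                  (\<forall>z\<in>topspace Z. h z = g z))"
      using tZ by (intro exI[of _ f]) auto
  qed (use t0 qc tZ in auto)
  then show ?thesis by blast
qed

definition open_shifts :: "'a :: topological_monoid_mult itself \<Rightarrow> bool" where
  "open_shifts _ \<longleftrightarrow>
     (\<forall>(a :: 'a) U. open U \<longrightarrow> open ((\<lambda>x. a * x) ` U) \<and> open ((\<lambda>x. x * a) ` U))"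

end

theory Submission
  imports Defs
begin

text \<open>Let \<open>U\<close> be a regular open neighbourhood of \<open>x = x \<cdot> 1\<close>, and choose open \<open>V \<ni> x\<close> and \<open>W \<ni> 1\<close>
  with \<open>V W \<subseteq> U\<close>.  With \<open>K\<close> the closure of \<open>V\<close>, the set \<open>K W\<close> is open, as a union of shifts of \<open>W\<close>,
  contains \<open>K\<close>, and lies in the closure of \<open>V W\<close>; hence \<open>K \<subseteq> U\<close>.  So \<open>S\<^sub>s\<^sub>r\<close> is \<open>T\<^sub>3\<close>.
  This passes to the \<open>T\<^sub>0\<close>-reflection, because every open set of \<open>S\<^sub>s\<^sub>r\<close> is a preimage of an open set
  under the reflection map.  Finally, a continuous map from \<open>S\<close> to a \<open>T\<^sub>3\<close> space remains continuous
  on \<open>S\<^sub>s\<^sub>r\<close>.\<close>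

section \<open>Semiregularization\<close>

lemma regular_openin_imp_openin_semiregularization:
  "regular_openin X U \<Longrightarrow> openin (semiregularization X) U"
  by (simp add: openin_semiregularization arbitrary_union_of_inc)

lemma openin_semiregularization_iff:
  "openin (semiregularization X) U \<longleftrightarrow> (\<forall>x\<in>U. \<exists>V. regular_openin X V \<and> x \<in> V \<and> V \<subseteq> U)"
  by (auto simp: openin_semiregularization arbitrary_union_of_alt)

lemma openin_semiregularization_imp_openin:
  assumes "openin (semiregularization X) U"
  shows "openin X U"
  using assms unfolding openin_semiregularization_iff regular_openin_def
  by (subst openin_subopen) blast

text \<open>The closure of the interior stays inside \<open>X closure_of U\<close>, and an open set
  lies in the interior of its own closure. As \<open>U\<close> is arbitrary, this is the source of
  regular open sets below.\<close>

lemma regular_openin_interior_closure_of: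
  "regular_openin X (X interior_of (X closure_of U))"
proof -
  have "X interior_of (X closure_of (X interior_of (X closure_of U)))
      \<subseteq> X interior_of (X closure_of U)"
    by (simp add: closure_of_minimal interior_of_mono interior_of_subset)
  moreover have "X interior_of (X closure_of U)
      \<subseteq> X interior_of (X closure_of (X interior_of (X closure_of U)))"
    by (simp add: closure_of_subset interior_of_maximal interior_of_subset_topspace)
  ultimately show ?thesis
    by (simp add: regular_openin_def)
qed

text \<open>For open \<open>V\<close> the complement of \<open>V\<close> is closed, so the
  complement of the closure is the interior of a closed set and hence regular open.\<close>

lemma closedin_semiregularization_closure_of:
  assumes "openin X V"
  shows "closedin (semiregularization X) (X closure_of V)"
proof -
  have "topspace X - X closure_of V = X interior_of (X closure_of (topspace X - V))"
    using assms by (simp add: closure_of_complement interior_of_complement interior_of_openin)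
  then show ?thesis
    by (simp add: closedin_def closure_of_subset_topspace regular_openin_interior_closure_of
        regular_openin_imp_openin_semiregularization)
qed

lemma continuous_map_semiregularization_id: "continuous_map X (semiregularization X) id"
  unfolding continuous_map_openin_preimage_eq
  by (auto intro: openin_Int openin_semiregularization_imp_openin)

lemma regular_space_closedin_neighbourhood:
  assumes "regular_space X" "openin X W" "x \<in> W"
  obtains U C where "openin X U" "closedin X C" "x \<in> U" "U \<subseteq> C" "C \<subseteq> W"
proof -
  have "neighbourhood_base_of (closedin X) X"
    using assms(1) by (simp add: neighbourhood_base_of_closedin)
  then have "\<exists>U C. openin X U \<and> closedin X C \<and> x \<in> U \<and> U \<subseteq> C \<and> C \<subseteq> W"
    using assms(2,3) by (simp add: neighbourhood_base_of)
  then show thesis using that by blast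
qed

text \<open>In a T3 target, a closed \<open>C\<close> fits between a neighbourhood \<open>P\<close>
  of \<open>f x\<close> and \<open>O'\<close>. The closure of the preimage of \<open>P\<close> then
  stays in the preimage of \<open>C\<close>, so its interior is a regular open neighbourhood of
  \<open>x\<close> that \<open>f\<close> maps into \<open>O'\<close>.\<close>

lemma continuous_map_from_semiregularization:
  assumes f: "continuous_map X Y f" and Y: "regular_space Y"
  shows "continuous_map (semiregularization X) Y f"
  unfolding continuous_map_def
proof (intro conjI allI impI)
  show "f \<in> topspace (semiregularization X) \<rightarrow> topspace Y"
    using f by (simp add: continuous_map_def)
  fix O' assume O': "openin Y O'"
  show "openin (semiregularization X) {x \<in> topspace (semiregularization X). f x \<in> O'}"
    unfolding openin_semiregularization_iff
  proof (intro ballI)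
    fix x assume "x \<in> {x \<in> topspace (semiregularization X). f x \<in> O'}"
    then have x: "x \<in> topspace X" "f x \<in> O'" by auto
    obtain P C where P: "openin Y P" "closedin Y C" "f x \<in> P" "P \<subseteq> C" "C \<subseteq> O'"
      using regular_space_closedin_neighbourhood[OF Y O' x(2)] .
    let ?P = "{x \<in> topspace X. f x \<in> P}" and ?C = "{x \<in> topspace X. f x \<in> C}"
    have "openin X ?P" "closedin X ?C"
      using f P(1,2) by (auto intro: openin_continuous_map_preimage closedin_continuous_map_preimage)
    moreover have "?P \<subseteq> ?C" using P(4) by auto
    ultimately have "?P \<subseteq> X interior_of (X closure_of ?P)" "X closure_of ?P \<subseteq> ?C"
      by (simp_all only: interior_of_maximal closure_of_subset closure_of_minimal openin_subset)
    then have "x \<in> X interior_of (X closure_of ?P)" "X interior_of (X closure_of ?P) \<subseteq> ?C"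
      using x(1) P(3) interior_of_subset[of X "X closure_of ?P"] by blast+
    then show "\<exists>V. regular_openin X V \<and> x \<in> V
        \<and> V \<subseteq> {x \<in> topspace (semiregularization X). f x \<in> O'}"
      using P(5) regular_openin_interior_closure_of[of X ?P]
      by (intro exI[of _ "X interior_of (X closure_of ?P)"]) auto
  qed
qed

section \<open>Monoids with open shifts\<close>

lemma open_mult_nhds:
  fixes a b :: "'a :: topological_semigroup_mult"
  assumes "open U" "a * b \<in> U"
  obtains V W where "open V" "a \<in> V" "open W" "b \<in> W" "\<And>x y. x \<in> V \<Longrightarrow> y \<in> W \<Longrightarrow> x * y \<in> U"
proof -
  have "\<forall>\<^sub>F z in nhds a \<times>\<^sub>F nhds b. fst z * snd z \<in> U"
    using tendsto_mult_Pair[of a b] eventually_nhds_in_open[OF assms]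
    unfolding filterlim_iff by blast
  then obtain P Q where PQ: "eventually P (nhds a)" "eventually Q (nhds b)"
    "\<And>x y. P x \<Longrightarrow> Q y \<Longrightarrow> x * y \<in> U"
    unfolding eventually_prod_filter by auto
  obtain V W where "open V" "a \<in> V" "\<forall>x\<in>V. P x" "open W" "b \<in> W" "\<forall>y\<in>W. Q y"
    using PQ(1,2) unfolding eventually_nhds by blast
  then show ?thesis
    using PQ(3) by (intro that[of V W]) auto
qed

lemma regular_space_semiregularization:
  assumes "open_shifts TYPE('a :: topological_monoid_mult)"
  shows "regular_space (semiregularization (euclidean :: 'a topology))"
  unfolding neighbourhood_base_of_closedin[symmetric] neighbourhood_base_of
proof (intro allI impI, elim conjE)
  fix G and x :: 'a
  assume "openin (semiregularization euclidean) G" "x \<in> G"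
  then obtain U where "regular_openin euclidean U" and xU: "x \<in> U" and UG: "U \<subseteq> G"
    unfolding openin_semiregularization_iff by blast
  then have U: "open U" "interior (closure U) = U"
    by (auto simp: regular_openin_def)
  obtain V W where V: "open V" "x \<in> V" and W: "open W" "1 \<in> W"
    and VW: "\<And>v w. v \<in> V \<Longrightarrow> w \<in> W \<Longrightarrow> v * w \<in> U"
    using open_mult_nhds[of U x 1] U(1) xU by auto
  \<comment> \<open>A basic neighbourhood of \<open>k * w\<close> contains some
    \<open>V' * W'\<close>. Moving \<open>k\<close> to a point \<open>v\<close> of \<open>V\<close>
    inside \<open>V'\<close> while keeping \<open>w\<close> fixed gives \<open>v * w\<close> in both
    \<open>U\<close> and that neighbourhood.\<close>
  have KW: "k * w \<in> closure U" if k: "k \<in> closure V" and w: "w \<in> W" for k w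
    unfolding closure_iff_nhds_not_empty
  proof (intro allI impI)
    fix A B assume "B \<subseteq> A" "open B" "k * w \<in> B"
    from this(2,3) obtain V' W' where "open V'" "k \<in> V'" "open W'" "w \<in> W'"
      "\<And>v u. v \<in> V' \<Longrightarrow> u \<in> W' \<Longrightarrow> v * u \<in> B"
      by (rule open_mult_nhds) blast
    moreover from this obtain v where "v \<in> V" "v \<in> V'"
      using k unfolding closure_iff_nhds_not_empty by blast
    ultimately have "v * w \<in> U \<inter> A"
      using VW w \<open>B \<subseteq> A\<close> by blast
    then show "U \<inter> A \<noteq> {}" by blast
  qed
  let ?KW = "\<Union>k\<in>closure V. (\<lambda>w. k * w) ` W"
  have "open ?KW"
    using assms W(1) unfolding open_shifts_def by blast
  moreover have "?KW \<subseteq> closure U"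
    using KW by blast
  moreover have "closure V \<subseteq> ?KW"
  proof
    fix k assume "k \<in> closure V"
    moreover have "k = k * 1" by simp
    ultimately show "k \<in> ?KW" using W(2) by blast
  qed
  \<comment> \<open>An open subset of \<open>closure U\<close> lies in
    \<open>interior (closure U)\<close>, which is \<open>U\<close> by regular openness.\<close>
  ultimately have "closure V \<subseteq> U"
    by (metis U(2) interior_maximal subset_trans)
  \<comment> \<open>\<open>V\<close> itself need not be open in the semiregularization, so
    \<open>interior (closure V)\<close> takes its place.\<close>
  moreover have "openin (semiregularization euclidean) (interior (closure V))"
    using regular_openin_interior_closure_of[of euclidean V]
    by (simp add: regular_openin_imp_openin_semiregularization)
  moreover have "closedin (semiregularization euclidean) (closure V)"
    using closedin_semiregularization_closure_of[of euclidean V] V(1) by simp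
  moreover have "x \<in> interior (closure V)"
    by (rule interiorI[OF V closure_subset])
  ultimately show "\<exists>U V. openin (semiregularization euclidean) U
      \<and> closedin (semiregularization euclidean) V \<and> x \<in> U \<and> U \<subseteq> V \<and> V \<subseteq> G"
    using UG interior_subset[of "closure V"]
    by (intro exI[of _ "interior (closure V)"] exI[of _ "closure V"]) auto
qed

section \<open>The T0-reflection\<close>

text \<open>The condition leaves exactly \<open>{}\<close>, \<open>{True}\<close> and
  \<open>UNIV\<close> as open sets. This space classifies open sets: they correspond to continuous
  maps into it.\<close>

definition sierpinski_topology :: "bool topology" where
  "sierpinski_topology = topology (\<lambda>U. False \<in> U \<longrightarrow> True \<in> U)"

lemma openin_sierpinski_topology:
  "openin sierpinski_topology U \<longleftrightarrow> (False \<in> U \<longrightarrow> True \<in> U)"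
  unfolding sierpinski_topology_def
  by (subst topology_inverse') (auto simp: istopology_def)

lemma topspace_sierpinski_topology [simp]: "topspace sierpinski_topology = UNIV"
  using openin_subset[of sierpinski_topology UNIV] by (auto simp: openin_sierpinski_topology)

lemma t0_space_sierpinski_topology: "t0_space sierpinski_topology"
  unfolding t0_space_def
  by (intro ballI impI exI[of _ "{True}"]) (auto simp: openin_sierpinski_topology)

lemma continuous_map_sierpinski_topology:
  "continuous_map X sierpinski_topology f \<longleftrightarrow> openin X {x \<in> topspace X. f x}"
proof
  assume "continuous_map X sierpinski_topology f"
  from openin_continuous_map_preimage[OF this, of "{True}"]
  show "openin X {x \<in> topspace X. f x}" by (simp add: openin_sierpinski_topology)
next
  assume f: "openin X {x \<in> topspace X. f x}"
  have "openin X {x \<in> topspace X. f x \<in> U}" if U: "False \<in> U \<longrightarrow> True \<in> U" for U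
  proof -
    have "f x \<in> U \<longleftrightarrow> False \<in> U \<or> True \<in> U \<and> f x" for x
      using U by (cases "f x") auto
    then have "{x \<in> topspace X. f x \<in> U} = (if False \<in> U then topspace X
        else if True \<in> U then {x \<in> topspace X. f x} else {})"
      by auto
    then show ?thesis using f by simp
  qed
  then show "continuous_map X sierpinski_topology f"
    by (simp add: continuous_map_def openin_sierpinski_topology)
qed

text \<open>The characteristic function of \<open>U\<close> is a continuous map to the Sierpinski
  space, so it factors through \<open>q\<close>; \<open>V\<close> is the set where the factor is
  true.\<close>

lemma t0_reflection_openin_preimage:
  fixes X :: "'x topology"
  assumes q: "is_reflection t0_space (t0_space :: 'x topology \<Rightarrow> bool) X Z q"
    and U: "openin X U"
  obtains V where "openin Z V" "U = {x \<in> topspace X. q x \<in> V}"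
proof -
  have "{x \<in> topspace X. x \<in> U} = U"
    using openin_subset[OF U] by auto
  then have "continuous_map X sierpinski_topology (\<lambda>x. x \<in> U)"
    using U by (simp add: continuous_map_sierpinski_topology)
  \<comment> \<open>The Sierpinski space is carried by \<open>bool\<close>, hence the change of test
    type.\<close>
  then obtain g where g: "continuous_map Z sierpinski_topology g"
      "\<forall>x\<in>topspace X. (x \<in> U) = g (q x)"
    using is_reflection_t0_space_any_type[OF q, where 'y = bool] t0_space_sierpinski_topology
    unfolding is_reflection_def by blast
  have "continuous_map X Z q"
    using q by (simp add: is_reflection_def)
  then have "U = {x \<in> topspace X. q x \<in> {z \<in> topspace Z. g z}}"
    using g(2) openin_subset[OF U] by (auto simp: continuous_map_def)
  with g(1) show ?thesis
    using that unfolding continuous_map_sierpinski_topology by blast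
qed

text \<open>Nested open and closed neighbourhoods in \<open>X\<close> descend to \<open>Z\<close>,
  since open sets of \<open>X\<close> are preimages and \<open>q\<close> is surjective.\<close>

lemma regular_space_t0_reflection:
  fixes X :: "'x topology"
  assumes q: "is_reflection t0_space (t0_space :: 'x topology \<Rightarrow> bool) X Z q"
    and X: "regular_space X"
  shows "regular_space Z"
  unfolding neighbourhood_base_of_closedin[symmetric] neighbourhood_base_of
proof (intro allI impI, elim conjE)
  have qc: "continuous_map X Z q" and qs: "q ` topspace X = topspace Z"
    using q by (simp_all add: is_reflection_def)
  fix G z assume G: "openin Z G" and z: "z \<in> G"
  obtain x where x: "x \<in> topspace X" "z = q x"
    using openin_subset[OF G] z qs by blast
  have "openin X {x \<in> topspace X. q x \<in> G}"
    using qc G by (rule openin_continuous_map_preimage)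
  then obtain A C where A: "openin X A" "closedin X C" "x \<in> A" "A \<subseteq> C"
      "C \<subseteq> {x \<in> topspace X. q x \<in> G}"
    by (rule regular_space_closedin_neighbourhood[OF X, where x = x]) (use x z in blast)+
  obtain A' where A': "openin Z A'" "A = {x \<in> topspace X. q x \<in> A'}"
    using t0_reflection_openin_preimage[OF q A(1)] .
  \<comment> \<open>\<open>C\<close> is handled through its complement:
    \<open>topspace Z - D\<close> will be the closed neighbourhood in \<open>Z\<close>.\<close>
  obtain D where D: "openin Z D" "topspace X - C = {x \<in> topspace X. q x \<in> D}"
    using t0_reflection_openin_preimage[OF q, of "topspace X - C"] A(2) by blast
  have "A' \<subseteq> topspace Z - D"
  proof
    fix w assume "w \<in> A'"
    moreover from this obtain y where "y \<in> topspace X" "w = q y"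
      using openin_subset[OF A'(1)] qs by blast
    ultimately show "w \<in> topspace Z - D" using A'(2) A(4) D(2) qs by blast
  qed
  moreover have "topspace Z - D \<subseteq> G"
  proof
    fix w assume "w \<in> topspace Z - D"
    moreover from this obtain y where "y \<in> topspace X" "w = q y"
      using qs by blast
    ultimately show "w \<in> G" using D(2) A(5) by blast
  qed
  moreover have "z \<in> A'"
    using A'(2) A(3) x(2) by blast
  ultimately show "\<exists>U V. openin Z U \<and> closedin Z V \<and> z \<in> U \<and> U \<subseteq> V \<and> V \<subseteq> G"
    using A'(1) D(1) by blast
qed

text \<open>For T3 spaces both T0 and T1 amount to Hausdorff.\<close>

lemma regular_T1_space_iff_t0: "regular_T1_space X \<longleftrightarrow> regular_space X \<and> t0_space X"
  unfolding regular_T1_space_def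
  using regular_t0_eq_Hausdorff_space regular_t1_eq_Hausdorff_space by blast

theorem theorem2p8:
  fixes Z :: "'z topology" and q :: "'a :: topological_monoid_mult \<Rightarrow> 'z"
  assumes "open_shifts TYPE('a)"
    and "is_reflection t0_space (t0_space :: 'a topology \<Rightarrow> bool)
           (semiregularization (euclidean :: 'a topology)) Z q"
  shows "is_reflection regular_T1_space (regular_T1_space :: 'y topology \<Rightarrow> bool)
           (euclidean :: 'a topology) Z (q \<circ> id)"
proof -
  let ?X = "semiregularization (euclidean :: 'a topology)"
  have t0: "is_reflection t0_space (t0_space :: 'y topology \<Rightarrow> bool) ?X Z q"
    using assms(2) by (rule is_reflection_t0_space_any_type)
  then have Z: "t0_space Z" "continuous_map ?X Z q" "q ` UNIV = topspace Z"
    by (simp_all add: is_reflection_def)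
  show ?thesis
    unfolding is_reflection_def
  proof (intro conjI allI impI)
    show "regular_T1_space Z"
      using regular_space_t0_reflection[OF assms(2) regular_space_semiregularization[OF assms(1)]]
        Z(1) by (simp add: regular_T1_space_iff_t0)
    show "continuous_map euclidean Z (q \<circ> id)"
      using continuous_map_semiregularization_id Z(2) by (rule continuous_map_compose)
    show "(q \<circ> id) ` topspace euclidean = topspace Z"
      using Z(3) by simp
  next
    fix Y :: "'y topology" and f
    assume Y: "regular_T1_space Y \<and> continuous_map (euclidean :: 'a topology) Y f"
    \<comment> \<open>T3 makes \<open>f\<close> continuous on \<open>?X\<close>, and T0 lets the
      universal property of \<open>q\<close> apply. Both existence and uniqueness carry over because
      \<open>?X\<close> has the same points as the monoid.\<close>
    then have "t0_space Y" "continuous_map ?X Y f"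
      by (auto simp: regular_T1_space_iff_t0 intro: continuous_map_from_semiregularization)
    then show "\<exists>g. continuous_map Z Y g \<and> (\<forall>x\<in>topspace euclidean. f x = g ((q \<circ> id) x)) \<and>
        (\<forall>h. continuous_map Z Y h \<and> (\<forall>x\<in>topspace euclidean. f x = h ((q \<circ> id) x)) \<longrightarrow>
             (\<forall>z\<in>topspace Z. h z = g z))"
      using t0 unfolding is_reflection_def by simp
  qed
qed

end
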